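(* For every finite skew brace $X$, the chain $(R_n(X))_{n\ge0}$ eventually reaches (and becomes constant at) a subskew brace $P_L(X)$ satisfying $$P_L(X)*P_L(X)=P_L(X).$$ Moreover, $P_L(X)$ is the largest subskew brace $C\le X$ satisfying $C*C=C$.
   Context: A skew (left) brace is a triple $X=(X,+,\cdot)$ such that $(X,+)$ and $(X,\cdot)$ are groups on the same set and $a\cdot(b+c)=a\cdot b-a+a\cdot c$ for all $a,b,c\in X$. A subskew brace is a subset that is a subgroup of both groups. Put $\lambda_a(b)=-a+a\cdot b$ and $a*b=\lambda_a(b)-b$; for subsets $S,T$, $S*T$ is the subgroup of $(X,+)$ generated by all $s*t$, $s\in S$, $t\in T$. An ideal of $X$ is a subgroup of $(X,+)$ that is invariant under every $\lambda_a$ and normal in both $(X,+)$ and $(X,\cdot)$. The left series is $X^1=X$, $X^{n+1}=X*X^n$; $X$ is left nilpotent if $X^n=0$ for some $n$. The left-nilpotent residual $\mathfrak{R}_L(X)$ is the intersection of all ideals $I$ of $X$ such that $X/I$ is left nilpotent. Set $R_0(X)=X$ and $R_{n+1}(X)=\mathfrak{R}_L(R_n(X))$ for $n\ge0$; this is a descending chain of subskew braces of $X$. *)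

theory Defs
  imports "HOL-Algebra.QuotRing" "HOL-Algebra.Generated_Groups"
begin

text \<open>
  A skew brace is carried by the record type of HOL-Algebra rings: the group $(X,+)$ is
  \<^term>\<open>add_monoid X\<close> and the group $(X,\cdot)$ is the multiplicative reduct of \<^term>\<open>X\<close>.
  Neither group is assumed commutative. That the zero and the one agree is a consequence
  of the axioms. A subskew brace is given by its carrier set \<open>S\<close>, and is turned into a structure
  by \<open>X\<lparr>carrier := S\<rparr>\<close>.
\<close>

locale skew_brace = group X + add: group "add_monoid X"
  for X :: "('a, 'm) ring_scheme" (structure) +
  assumes brace_distrib:
    "\<lbrakk>a \<in> carrier X; b \<in> carrier X; c \<in> carrier X\<rbrakk>
      \<Longrightarrow> a \<otimes> (b \<oplus> c) = ((a \<otimes> b) \<ominus> a) \<oplus> (a \<otimes> c)"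

definition subskew_brace :: "'a set \<Rightarrow> ('a, 'm) ring_scheme \<Rightarrow> bool" where
  "subskew_brace S X \<longleftrightarrow> subgroup S (add_monoid X) \<and> subgroup S X"

definition brace_lambda :: "('a, 'm) ring_scheme \<Rightarrow> 'a \<Rightarrow> 'a \<Rightarrow> 'a" where
  "brace_lambda X a b = (\<ominus>\<^bsub>X\<^esub> a) \<oplus>\<^bsub>X\<^esub> (a \<otimes>\<^bsub>X\<^esub> b)"

definition star :: "('a, 'm) ring_scheme \<Rightarrow> 'a \<Rightarrow> 'a \<Rightarrow> 'a" where
  "star X a b = brace_lambda X a b \<ominus>\<^bsub>X\<^esub> b"

definition star_set :: "('a, 'm) ring_scheme \<Rightarrow> 'a set \<Rightarrow> 'a set \<Rightarrow> 'a set" where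
  "star_set X S T = generate (add_monoid X) {star X s t | s t. s \<in> S \<and> t \<in> T}"

definition brace_ideal :: "'a set \<Rightarrow> ('a, 'm) ring_scheme \<Rightarrow> bool" where
  "brace_ideal I X \<longleftrightarrow>
     I \<lhd> add_monoid X \<and> I \<lhd> X \<and> (\<forall>a \<in> carrier X. brace_lambda X a ` I \<subseteq> I)"

text \<open>The series is indexed from 1; the value at index 0 is a dummy.\<close>

fun left_series :: "('a, 'm) ring_scheme \<Rightarrow> nat \<Rightarrow> 'a set" where
  "left_series X 0 = carrier X"
| "left_series X (Suc 0) = carrier X"
| "left_series X (Suc (Suc n)) = star_set X (carrier X) (left_series X (Suc n))"

definition left_nilpotent :: "('a, 'm) ring_scheme \<Rightarrow> bool" where
  "left_nilpotent X \<longleftrightarrow> (\<exists>n\<ge>1. left_series X n = {\<zero>\<^bsub>X\<^esub>})"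

text \<open>
  The library's \<^term>\<open>X Quot I\<close> consists of the additive cosets \<open>I + a\<close>, with addition of cosets
  as sets and with \<open>(I + a) \<cdot> (I + b) = I + a \<cdot> b\<close>; for an ideal \<open>I\<close> of a skew brace the additive
  and the multiplicative cosets coincide, so this is the quotient skew brace.
\<close>

definition left_nilpotent_residual :: "('a, 'm) ring_scheme \<Rightarrow> 'a set" where
  "left_nilpotent_residual X = \<Inter> {I. brace_ideal I X \<and> left_nilpotent (X Quot I)}"

primrec residual_chain :: "('a, 'm) ring_scheme \<Rightarrow> nat \<Rightarrow> 'a set" where
  "residual_chain X 0 = carrier X"
| "residual_chain X (Suc n) = left_nilpotent_residual (X\<lparr>carrier := residual_chain X n\<rparr>)"

end

theory Submission imports Defs begin

text \<open>
  The residual is squeezed between two easy bounds.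

  From above: \<open>X * X\<close> is an ideal of \<open>X\<close> (lemma \<open>square_ideal\<close>), and all star products vanish in
  \<open>X / (X * X)\<close>, so this quotient is left nilpotent and \<open>R\<^sub>L(X) \<subseteq> X * X\<close>
  (lemma \<open>residual_subset_square\<close>).
  Hence a skew brace that equals its own residual satisfies \<open>X = X * X\<close>.

  From below: if \<open>C\<close> is star-perfect, that is \<open>C = C * C\<close>, then \<open>C\<close> survives in every term of the left series, since
  \<open>C \<subseteq> X\<^sup>n\<close> gives \<open>C = C * C \<subseteq> X * X\<^sup>n = X\<^sup>n\<^sup>+\<^sup>1\<close>. The left series of \<open>X / I\<close> is the image of the
  left series of \<open>X\<close>, so \<open>X / I\<close> is left nilpotent exactly when \<open>X\<^sup>n \<subseteq> I\<close> for some \<open>n \<ge> 1\<close>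
  (lemma \<open>left_nilpotent_quot_iff\<close>); every such \<open>I\<close> therefore contains \<open>C\<close>, and so does \<open>R\<^sub>L(X)\<close>
  (lemma \<open>star_perfect_subset_residual\<close>).

  The terms of the chain of iterated residuals are subskew braces, so both bounds can be applied
  inside each of them. In a finite \<open>X\<close> the descending chain stabilises at some \<open>P\<close>, which is its
  own residual: the first bound gives \<open>P * P = P\<close>, and the second one, iterated along the chain,
  puts every \<open>C = C * C\<close> inside \<open>P\<close>.
\<close>

section \<open>Arithmetic of skew braces\<close>

context skew_brace
begin

lemmas add_closed = add.m_closed[simplified]
lemmas zero_closed = add.one_closed[simplified]
lemmas neg_closed = add.inv_closed[simplified, folded a_inv_def]

text \<open>
  Together with \<open>neg_add_cancel_left\<close>, these form a complete rewrite system for words in the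
  non-commutative group \<open>(X,+)\<close>, so that additive identities are decided by simplification.
\<close>

lemmas add_word_simps =
  add.m_assoc[simplified] add.l_one[simplified] add.r_one[simplified]
  add.l_inv[simplified, folded a_inv_def] add.r_inv[simplified, folded a_inv_def]
  add.inv_mult_group[simplified, folded a_inv_def] add.inv_inv[simplified, folded a_inv_def]
  add.inv_one[simplified, folded a_inv_def]

lemma neg_add_cancel_left:
  "a \<in> carrier X \<Longrightarrow> b \<in> carrier X \<Longrightarrow> \<ominus> a \<oplus> (a \<oplus> b) = b"
  "a \<in> carrier X \<Longrightarrow> b \<in> carrier X \<Longrightarrow> a \<oplus> (\<ominus> a \<oplus> b) = b"
  using add_word_simps(1)[of "\<ominus> a" a b] add_word_simps(1)[of a "\<ominus> a" b]
  by (simp_all add: add_word_simps neg_closed)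

lemmas add_simps = add_word_simps neg_add_cancel_left a_minus_def
  add_closed zero_closed neg_closed

lemma lambda_closed: "a \<in> carrier X \<Longrightarrow> b \<in> carrier X \<Longrightarrow> brace_lambda X a b \<in> carrier X"
  by (simp add: brace_lambda_def add_simps)

lemma star_closed: "a \<in> carrier X \<Longrightarrow> b \<in> carrier X \<Longrightarrow> star X a b \<in> carrier X"
  by (simp add: star_def lambda_closed add_simps)

lemma mult_eq_add_lambda:
  "a \<in> carrier X \<Longrightarrow> b \<in> carrier X \<Longrightarrow> a \<otimes> b = a \<oplus> brace_lambda X a b"
  by (simp add: brace_lambda_def add_simps)

lemma lambda_eq_star_add:
  "a \<in> carrier X \<Longrightarrow> b \<in> carrier X \<Longrightarrow> brace_lambda X a b = star X a b \<oplus> b"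
  by (simp add: star_def lambda_closed add_simps)

lemma lambda_add:
  assumes "a \<in> carrier X" "b \<in> carrier X" "c \<in> carrier X"
  shows "brace_lambda X a (b \<oplus> c) = brace_lambda X a b \<oplus> brace_lambda X a c"
  using assms by (simp add: brace_lambda_def brace_distrib add_simps)

text \<open>
  Distributing the product \<open>1 \<cdot> (0 + 0)\<close> leaves \<open>0 = -1\<close>.
\<close>

lemma zero_eq_one: "\<zero> = \<one>"
proof -
  have "\<one> \<otimes> (\<zero> \<oplus> \<zero>) = ((\<one> \<otimes> \<zero>) \<ominus> \<one>) \<oplus> (\<one> \<otimes> \<zero>)"
    by (rule brace_distrib) (simp_all add: add_simps)
  then have "\<ominus> \<one> = \<zero>" by (simp add: add_simps)
  then have "\<ominus> (\<ominus> \<one>) = \<zero>" by (simp add: add_simps)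
  then show ?thesis by (simp add: add_simps)
qed

lemma lambda_one: "b \<in> carrier X \<Longrightarrow> brace_lambda X \<one> b = b"
  by (simp add: brace_lambda_def add_simps flip: zero_eq_one)

text \<open>
  \<open>\<lambda>\<close> is an action of \<open>(X,\<cdot>)\<close>: since \<open>b \<cdot> c = b + \<lambda>\<^sub>b(c)\<close>, this is associativity of \<open>a \<cdot> b \<cdot> c\<close>
  expanded by the brace axiom.
\<close>

lemma lambda_mult:
  assumes "a \<in> carrier X" "b \<in> carrier X" "c \<in> carrier X"
  shows "brace_lambda X a (brace_lambda X b c) = brace_lambda X (a \<otimes> b) c"
proof -
  have "a \<otimes> (b \<oplus> brace_lambda X b c) = (a \<otimes> b) \<otimes> c"
    using assms by (simp add: m_assoc flip: mult_eq_add_lambda)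
  then have "a \<otimes> b \<oplus> (\<ominus> a \<oplus> (a \<otimes> brace_lambda X b c)) = (a \<otimes> b) \<otimes> c"
    using assms by (simp add: brace_distrib lambda_closed add_simps)
  then have "\<ominus> (a \<otimes> b) \<oplus> (a \<otimes> b \<oplus> brace_lambda X a (brace_lambda X b c))
      = brace_lambda X (a \<otimes> b) c"
    by (simp add: brace_lambda_def)
  then show ?thesis
    using assms by (simp add: lambda_closed add_simps)
qed

lemma subskew_brace_closed: "subskew_brace S X \<Longrightarrow> S \<subseteq> carrier X"
  by (simp add: subskew_brace_def subgroup.subset)

lemma neg_sub:
  assumes "subskew_brace S X" "a \<in> S"
  shows "\<ominus>\<^bsub>X\<lparr>carrier := S\<rparr>\<^esub> a = \<ominus> a"
  using add.m_inv_consistent[of S a] assms by (simp add: subskew_brace_def a_inv_def)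

lemma skew_brace_sub:
  assumes "subskew_brace S X"
  shows "skew_brace (X\<lparr>carrier := S\<rparr>)"
proof -
  have S: "subgroup S (add_monoid X)" "subgroup S X"
    using assms by (auto simp: subskew_brace_def)
  have grp: "group (X\<lparr>carrier := S\<rparr>)" "group (add_monoid (X\<lparr>carrier := S\<rparr>))"
    using subgroup.subgroup_is_group[OF S(2) group_axioms]
      subgroup.subgroup_is_group[OF S(1) add.group_axioms] by simp_all
  have "a \<in> carrier X" if "a \<in> S" for a
    using S(2) that by (rule subgroup.mem_carrier)
  then show ?thesis
    using grp
    by (auto simp: skew_brace_def skew_brace_axioms_def a_minus_def neg_sub[OF assms] brace_distrib)
qed

lemma star_set_gens_closed:
  "A \<subseteq> carrier X \<Longrightarrow> B \<subseteq> carrier X \<Longrightarrow> {star X a b | a b. a \<in> A \<and> b \<in> B} \<subseteq> carrier X"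
  using star_closed by blast

lemma star_set_sub:
  assumes S: "subskew_brace S X" and "A \<subseteq> S" "B \<subseteq> S"
  shows "star_set (X\<lparr>carrier := S\<rparr>) A B = star_set X A B"
proof -
  have sg: "subgroup S (add_monoid X)"
    using S by (simp add: subskew_brace_def)
  have eq: "star (X\<lparr>carrier := S\<rparr>) a b = star X a b" if "a \<in> S" "b \<in> S" for a b
    using that by (simp add: star_def brace_lambda_def a_minus_def neg_sub[OF S])
  interpret sub: skew_brace "X\<lparr>carrier := S\<rparr>" using S by (rule skew_brace_sub)
  let ?G = "{star X a b | a b. a \<in> A \<and> b \<in> B}"
  have G: "{star (X\<lparr>carrier := S\<rparr>) a b | a b. a \<in> A \<and> b \<in> B} = ?G"
    using eq assms(2,3) by (intro Collect_cong) (metis subsetD)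
  have "?G \<subseteq> S"
    using sub.star_set_gens_closed[of A B] assms(2,3) unfolding G by simp
  from add.generate_consistent[OF this sg] show ?thesis
    unfolding star_set_def G by simp
qed

lemma star_set_subgroup:
  "A \<subseteq> carrier X \<Longrightarrow> B \<subseteq> carrier X \<Longrightarrow> subgroup (star_set X A B) (add_monoid X)"
  unfolding star_set_def by (rule add.generate_is_subgroup) (simp add: star_set_gens_closed)

lemma star_set_mono:
  "A \<subseteq> A' \<Longrightarrow> B \<subseteq> B' \<Longrightarrow> star_set X A B \<subseteq> star_set X A' B'"
  unfolding star_set_def by (rule add.mono_generate) blast

lemma left_series_closed: "left_series X (Suc n) \<subseteq> carrier X"
proof (induction n)
  case (Suc n)
  then show ?case using subgroup.subset[OF star_set_subgroup[OF subset_refl Suc]] by simp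
qed simp

section \<open>The square of a skew brace\<close>

abbreviation square :: "'a set" where
  "square \<equiv> star_set X (carrier X) (carrier X)"

lemma star_in_square: "a \<in> carrier X \<Longrightarrow> b \<in> carrier X \<Longrightarrow> star X a b \<in> square"
  unfolding star_set_def by (rule generate.incl) blast

lemma square_subgroup: "subgroup square (add_monoid X)"
  by (simp add: star_set_subgroup)

lemma square_closed: "z \<in> square \<Longrightarrow> z \<in> carrier X"
  using subgroup.mem_carrier[OF square_subgroup] by simp

lemma square_add: "y \<in> square \<Longrightarrow> z \<in> square \<Longrightarrow> y \<oplus> z \<in> square"
  using subgroup.m_closed[OF square_subgroup] by simp

lemma square_neg: "z \<in> square \<Longrightarrow> \<ominus> z \<in> square"
  using subgroup.m_inv_closed[OF square_subgroup] by (simp add: a_inv_def)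

text \<open>
  Expanding \<open>x * (y + z)\<close> by additivity of \<open>\<lambda>\<^sub>x\<close> gives \<open>x * y + (y + x * z - y)\<close>: an additive
  conjugate of a star product is a combination of two star products.
\<close>

lemma conj_star_in_square:
  assumes "x \<in> carrier X" "y \<in> carrier X" "z \<in> carrier X"
  shows "y \<oplus> star X x z \<oplus> \<ominus> y \<in> square"
proof -
  have "y \<oplus> star X x z \<oplus> \<ominus> y = \<ominus> star X x y \<oplus> star X x (y \<oplus> z)"
    using assms by (simp add: star_def lambda_add lambda_closed add_simps)
  then show ?thesis
    using assms by (simp add: square_add square_neg star_in_square add_closed)
qed

lemma square_normal_add: "square \<lhd> add_monoid X"
proof (rule add.normal_invI[OF square_subgroup], simp flip: a_inv_def)
  fix y h assume y: "y \<in> carrier X" and "h \<in> square"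
  from this(2) show "y \<oplus> h \<oplus> \<ominus> y \<in> square"
    unfolding star_set_def
  proof (induction rule: generate.induct)
    case one
    then show ?case
      using y generate.one[of "add_monoid X"] by (simp add: add_simps)
  next
    case (incl h)
    then show ?case using y conj_star_in_square by (auto simp: star_set_def)
  next
    case (inv h)
    then obtain x z where h: "h = star X x z" "x \<in> carrier X" "z \<in> carrier X" by auto
    have "y \<oplus> \<ominus> h \<oplus> \<ominus> y = \<ominus> (y \<oplus> h \<oplus> \<ominus> y)"
      using y h by (simp add: star_closed add_simps)
    then show ?case
      using square_neg[OF conj_star_in_square[OF h(2) y h(3)]] h(1)
      by (simp add: star_set_def flip: a_inv_def)
  next
    case (eng h k)
    have hk: "h \<in> carrier X" "k \<in> carrier X"
      using eng(1,2)[folded star_set_def] square_closed by blast+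
    have "y \<oplus> (h \<oplus> k) \<oplus> \<ominus> y = (y \<oplus> h \<oplus> \<ominus> y) \<oplus> (y \<oplus> k \<oplus> \<ominus> y)"
      using y hk by (simp add: add_simps)
    then show ?case
      using square_add[unfolded star_set_def, OF eng(3,4)] by (simp only: monoid.simps)
  qed
qed

text \<open>
  The square absorbs every star product with arbitrary arguments, in particular \<open>a * z\<close>, and
  \<open>\<lambda>\<^sub>a(z) = a * z + z\<close>.
\<close>

lemma lambda_square: "a \<in> carrier X \<Longrightarrow> z \<in> square \<Longrightarrow> brace_lambda X a z \<in> square"
  using square_closed by (simp add: lambda_eq_star_add square_add star_in_square)

text \<open>
  Closure under products is \<open>a \<cdot> b = a + \<lambda>\<^sub>a(b)\<close>; the same formula for the product of the inverse of
  \<open>a\<close> with \<open>a\<close> writes that inverse as minus a value of \<open>\<lambda>\<close> at \<open>a\<close>.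
\<close>

lemma lambda_invariant_mult_subgroup:
  assumes I: "subgroup I (add_monoid X)"
    and inv: "\<And>a z. a \<in> carrier X \<Longrightarrow> z \<in> I \<Longrightarrow> brace_lambda X a z \<in> I"
  shows "subgroup I X"
proof (rule subgroupI)
  show sub: "I \<subseteq> carrier X" using subgroup.subset[OF I] by simp
  show "I \<noteq> {}" using subgroup.one_closed[OF I] by auto
  fix a assume a: "a \<in> I"
  then have ac: "a \<in> carrier X" using sub by auto
  have "inv a \<oplus> brace_lambda X (inv a) a = \<zero>"
    using ac by (simp add: zero_eq_one flip: mult_eq_add_lambda)
  then have "\<ominus> brace_lambda X (inv a) a = inv a"
    using add.inv_equality[of "inv a" "brace_lambda X (inv a) a"] ac
    by (simp add: lambda_closed flip: a_inv_def)
  then show "inv a \<in> I"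
    using subgroup.m_inv_closed[OF I inv[OF inv_closed[OF ac] a]] by (simp flip: a_inv_def)
next
  fix a b assume "a \<in> I" "b \<in> I"
  moreover from this have "a \<in> carrier X" "b \<in> carrier X"
    using subgroup.subset[OF I] by auto
  ultimately show "a \<otimes> b \<in> I"
    using inv subgroup.m_closed[OF I] by (simp add: mult_eq_add_lambda)
qed

text \<open>
  Writing \<open>w\<close> for the conjugate of \<open>z\<close> by \<open>a\<close>, the two sides of \<open>w \<cdot> a = a \<cdot> z\<close> are
  \<open>w + w * a + a\<close> and \<open>a + \<lambda>\<^sub>a(z) = z' + a\<close>, where \<open>z' = a + \<lambda>\<^sub>a(z) - a\<close> lies in the square by
  additive normality. Cancelling \<open>a\<close> leaves \<open>w = z' - w * a\<close>.
\<close>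

lemma square_normal_mult: "square \<lhd> X"
proof (rule normal_invI)
  show "subgroup square X"
    using square_subgroup lambda_square by (rule lambda_invariant_mult_subgroup)
  fix a z assume a: "a \<in> carrier X" and z: "z \<in> square"
  note zc = square_closed[OF z]
  define w where "w = a \<otimes> z \<otimes> inv a"
  define z' where "z' = a \<oplus> brace_lambda X a z \<oplus> \<ominus> a"
  have wc: "w \<in> carrier X" using a zc by (simp add: w_def)
  have z': "z' \<in> square"
    using normal.inv_op_closed2[OF square_normal_add, of a "brace_lambda X a z"]
      lambda_square[OF a z] a by (simp add: z'_def a_inv_def)
  have "w \<otimes> a = a \<otimes> z"
    using a zc by (simp add: w_def m_assoc)
  also have "\<dots> = z' \<oplus> a"
    using a zc by (simp add: z'_def mult_eq_add_lambda lambda_closed add_simps)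
  finally have "w \<otimes> a = z' \<oplus> a" .
  then have "w \<oplus> (star X w a \<oplus> a) = z' \<oplus> a"
    using wc a by (simp add: mult_eq_add_lambda lambda_eq_star_add)
  then have "w \<oplus> (star X w a \<oplus> a) \<oplus> \<ominus> a \<oplus> \<ominus> star X w a = z' \<oplus> a \<oplus> \<ominus> a \<oplus> \<ominus> star X w a"
    by simp
  then have "w = z' \<oplus> \<ominus> star X w a"
    using wc a square_closed[OF z'] by (simp add: star_closed add_simps)
  then show "a \<otimes> z \<otimes> inv a \<in> square"
    using z' wc a by (metis w_def square_add square_neg star_in_square)
qed

lemma square_ideal: "brace_ideal square X"
  using square_normal_add square_normal_mult lambda_square by (auto simp: brace_ideal_def)

section \<open>Quotients\<close>

context
  fixes I assumes I: "brace_ideal I X"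
begin

lemma add_monoid_quot: "add_monoid (X Quot I) = add_monoid X Mod I"
  by (simp add: FactRing_def FactGroup_def A_RCOSETS_def set_add_def)

interpretation addI: normal I "add_monoid X"
  using I by (simp add: brace_ideal_def)

interpretation multI: normal I X
  using I by (simp add: brace_ideal_def)

lemma ideal_closed: "z \<in> I \<Longrightarrow> z \<in> carrier X"
  using addI.subset by auto

lemma proj_hom: "group_hom (add_monoid X) (add_monoid (X Quot I)) (\<lambda>a. I +> a)"
  unfolding add_monoid_quot a_r_coset_def
  by (intro group_hom.intro group_hom_axioms.intro add.group_axioms
      addI.factorgroup_is_group addI.r_coset_hom_Mod)

text \<open>
  Both cosets are equal to the corresponding left cosets, and \<open>a + z = a \<cdot> z'\<close> where \<open>z = \<lambda>\<^sub>a(z')\<close>;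
  the ideal is stable under \<open>\<lambda>\<^sub>a\<close> and its inverse. This makes multiplication of additive cosets
  well defined.
\<close>

lemma add_coset_eq_mult_coset:
  assumes a: "a \<in> carrier X"
  shows "I +> a = I #> a"
proof -
  have lam: "brace_lambda X b z \<in> I" if "b \<in> carrier X" "z \<in> I" for b z
    using I that by (auto simp: brace_ideal_def)
  have "I +> a = a <#\<^bsub>add_monoid X\<^esub> I"
    using addI.coset_eq a by (simp add: a_r_coset_def)
  also have "\<dots> = a <# I"
  proof
    show "a <#\<^bsub>add_monoid X\<^esub> I \<subseteq> a <# I"
    proof
      fix x assume "x \<in> a <#\<^bsub>add_monoid X\<^esub> I"
      then obtain z where z: "z \<in> I" "x = a \<oplus> z" by (auto simp: l_coset_def)
      have "brace_lambda X a (brace_lambda X (inv a) z) = z"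
        using a z(1) by (simp add: lambda_mult ideal_closed lambda_one)
      then have "x = a \<otimes> brace_lambda X (inv a) z"
        using a z by (simp add: mult_eq_add_lambda lambda_closed ideal_closed)
      then show "x \<in> a <# I" using lam[OF _ z(1)] a by (auto simp: l_coset_def)
    qed
    show "a <# I \<subseteq> a <#\<^bsub>add_monoid X\<^esub> I"
      using lam a by (auto simp: l_coset_def mult_eq_add_lambda ideal_closed)
  qed
  also have "\<dots> = I #> a" using multI.coset_eq a by simp
  finally show ?thesis .
qed

lemma proj_add:
  assumes "a \<in> carrier X" "b \<in> carrier X"
  shows "(I +> a) \<oplus>\<^bsub>X Quot I\<^esub> (I +> b) = I +> (a \<oplus> b)"
  using group_hom.hom_mult[OF proj_hom, of a b] assms by simp

lemma proj_neg:
  assumes "a \<in> carrier X"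
  shows "\<ominus>\<^bsub>X Quot I\<^esub> (I +> a) = I +> (\<ominus> a)"
  using group_hom.hom_inv[OF proj_hom, of a] assms by (simp add: a_inv_def)

lemma proj_mult:
  assumes a: "a \<in> carrier X" and b: "b \<in> carrier X"
  shows "(I +> a) \<otimes>\<^bsub>X Quot I\<^esub> (I +> b) = I +> (a \<otimes> b)"
proof -
  have eq: "I +> (a' \<otimes> b') = I #> (a \<otimes> b)" if a': "a' \<in> I #> a" and b': "b' \<in> I #> b" for a' b'
  proof -
    have c: "a' \<in> carrier X" "b' \<in> carrier X"
      using that a b r_coset_subset_G[OF multI.subset] by auto
    have "a' \<otimes> b' \<in> I #> (a \<otimes> b)"
      using multI.rcos_sum[OF a b] a' b' by (auto simp: set_mult_def)
    then show ?thesis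
      using a b c repr_independence[OF _ _ multI.subgroup_axioms]
      by (simp add: add_coset_eq_mult_coset)
  qed
  have "a \<in> I #> a" "b \<in> I #> b"
    using a b rcos_self multI.subgroup_axioms by auto
  then have "(\<Union>a'\<in>I #> a. \<Union>b'\<in>I #> b. I +> (a' \<otimes> b')) = I #> (a \<otimes> b)"
    using eq by blast
  then show ?thesis
    using a b by (simp add: FactRing_def rcoset_mult_def add_coset_eq_mult_coset)
qed

lemma proj_star:
  assumes "a \<in> carrier X" "b \<in> carrier X"
  shows "star (X Quot I) (I +> a) (I +> b) = I +> star X a b"
  using assms
  by (simp add: star_def brace_lambda_def a_minus_def proj_add proj_neg proj_mult add_simps)

lemma proj_star_set:
  assumes "A \<subseteq> carrier X" "B \<subseteq> carrier X"
  shows "star_set (X Quot I) ((+>) I ` A) ((+>) I ` B) = (+>) I ` star_set X A B"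
proof -
  have "{star (X Quot I) s t | s t. s \<in> (+>) I ` A \<and> t \<in> (+>) I ` B}
      = (\<lambda>a. I +> a) ` {star X a b | a b. a \<in> A \<and> b \<in> B}" (is "?L = ?R")
  proof
    show "?L \<subseteq> ?R" using assms proj_star by blast
    show "?R \<subseteq> ?L"
    proof
      fix x assume "x \<in> ?R"
      then obtain a b where ab: "x = I +> star X a b" "a \<in> A" "b \<in> B" by blast
      then have "x = star (X Quot I) (I +> a) (I +> b)" using assms by (metis proj_star subsetD)
      then show "x \<in> ?L" using ab by blast
    qed
  qed
  then show ?thesis
    using group_hom.generate_img[OF proj_hom, of "{star X a b | a b. a \<in> A \<and> b \<in> B}"]
      star_set_gens_closed[OF assms]
    by (simp add: star_set_def)
qed

lemma proj_carrier: "carrier (X Quot I) = (+>) I ` carrier X"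
  by (auto simp: FactRing_def A_RCOSETS_def' )

text \<open>
  The index 0 of the left series is a dummy, so statements about the series are made for \<open>Suc n\<close>.
\<close>

lemma proj_left_series: "left_series (X Quot I) (Suc n) = (+>) I ` left_series X (Suc n)"
proof (induction n)
  case 0
  show ?case by (simp add: proj_carrier)
next
  case (Suc n)
  then show ?case
    by (simp add: proj_carrier proj_star_set left_series_closed)
qed

lemma zero_in_left_series: "\<zero> \<in> left_series X (Suc n)"
proof (cases n)
  case 0
  then show ?thesis by (simp add: add_simps)
next
  case (Suc m)
  then show ?thesis
    using subgroup.one_closed[OF star_set_subgroup[OF subset_refl left_series_closed[of m]]]
    by simp
qed

lemma proj_eq_zero_iff: "a \<in> carrier X \<Longrightarrow> I +> a = I \<longleftrightarrow> a \<in> I"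
  using add.coset_join1[of I a] add.coset_join2[of a I] addI.subgroup_axioms
  by (auto simp: a_r_coset_def)

text \<open>
  A subset of \<open>X\<close> containing 0 has trivial image modulo \<open>I\<close> if and only if it is contained in \<open>I\<close>.
\<close>

lemma left_nilpotent_quot_iff: "left_nilpotent (X Quot I) \<longleftrightarrow> (\<exists>n. left_series X (Suc n) \<subseteq> I)"
proof -
  have "left_series (X Quot I) (Suc n) = {\<zero>\<^bsub>X Quot I\<^esub>} \<longleftrightarrow> left_series X (Suc n) \<subseteq> I" for n
  proof -
    have "(+>) I ` left_series X (Suc n) = {I} \<longleftrightarrow> (\<forall>a \<in> left_series X (Suc n). I +> a = I)"
      using zero_in_left_series[of n] by auto
    also have "\<dots> \<longleftrightarrow> left_series X (Suc n) \<subseteq> I"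
      using left_series_closed[of n] proj_eq_zero_iff by blast
    finally show ?thesis
      unfolding proj_left_series by (simp add: FactRing_def)
  qed
  moreover have "left_nilpotent (X Quot I) \<longleftrightarrow>
      (\<exists>n. left_series (X Quot I) (Suc n) = {\<zero>\<^bsub>X Quot I\<^esub>})"
    unfolding left_nilpotent_def by (metis One_nat_def Suc_le_D le_add1 plus_1_eq_Suc)
  ultimately show ?thesis by simp
qed

end

section \<open>The left-nilpotent residual\<close>

text \<open>
  The second term \<open>X\<^sup>2\<close> of the left series is the square itself, so the quotient by the square is left
  nilpotent and the square is one of the ideals being intersected.
\<close>

lemma residual_subset_square: "left_nilpotent_residual X \<subseteq> square"
proof -
  have "left_series X (Suc (Suc 0)) \<subseteq> square" by simp
  then have "left_nilpotent (X Quot square)"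
    using left_nilpotent_quot_iff[OF square_ideal] by blast
  then show ?thesis
    unfolding left_nilpotent_residual_def using square_ideal by blast
qed

lemma residual_subset: "left_nilpotent_residual X \<subseteq> carrier X"
  using residual_subset_square square_closed by blast

text \<open>
  An intersection of ideals is a subgroup for both operations once it is non-empty as a family; the
  square witnesses this.
\<close>

lemma residual_subskew_brace: "subskew_brace (left_nilpotent_residual X) X"
proof -
  let ?F = "{I. brace_ideal I X \<and> left_nilpotent (X Quot I)}"
  have "left_series X (Suc (Suc 0)) \<subseteq> square" by simp
  then have "square \<in> ?F"
    using left_nilpotent_quot_iff[OF square_ideal] square_ideal by blast
  then have "?F \<noteq> {}" by blast
  moreover have "subgroup I (add_monoid X)" "subgroup I X" if "I \<in> ?F" for I
    using that by (auto simp: brace_ideal_def normal_imp_subgroup)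
  ultimately show ?thesis
    unfolding subskew_brace_def left_nilpotent_residual_def
    using subgroups_Inter[of ?F] add.subgroups_Inter[of ?F] by simp
qed

text \<open>
  Monotonicity of the star product carries \<open>C \<subseteq> X\<^sup>n\<close> to \<open>C = C * C \<subseteq> X * X\<^sup>n\<close>.
\<close>

lemma star_perfect_subset_left_series:
  assumes "C \<subseteq> carrier X" "star_set X C C = C"
  shows "C \<subseteq> left_series X (Suc n)"
proof (induction n)
  case 0
  then show ?case using assms by simp
next
  case (Suc n)
  then show ?case using star_set_mono[OF assms(1) Suc] assms(2) by simp
qed

lemma star_perfect_subset_residual:
  assumes "C \<subseteq> carrier X" "star_set X C C = C"
  shows "C \<subseteq> left_nilpotent_residual X"
  unfolding left_nilpotent_residual_def
  using left_nilpotent_quot_iff star_perfect_subset_left_series[OF assms] by blast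

section \<open>The chain of iterated residuals\<close>

lemma residual_chain_subskew_brace: "subskew_brace (residual_chain X n) X"
proof (induction n)
  case 0
  then show ?case by (simp add: subskew_brace_def subgroup_self add.subgroup_self[simplified])
next
  case (Suc n)
  interpret R: skew_brace "X\<lparr>carrier := residual_chain X n\<rparr>"
    using Suc by (rule skew_brace_sub)
  show ?case
    using R.residual_subskew_brace Suc
      incl_subgroup[of "residual_chain X n"] add.incl_subgroup[of "residual_chain X n"]
    by (simp add: subskew_brace_def)
qed

lemma residual_chain_Suc_subset: "residual_chain X (Suc n) \<subseteq> residual_chain X n"
  using skew_brace.residual_subset[OF skew_brace_sub[OF residual_chain_subskew_brace[of n]]]
  by simp

lemma residual_chain_Suc_subset_star:
  "residual_chain X (Suc n) \<subseteq> star_set X (residual_chain X n) (residual_chain X n)"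
  using skew_brace.residual_subset_square[OF skew_brace_sub[OF residual_chain_subskew_brace[of n]]]
  by (simp add: star_set_sub[OF residual_chain_subskew_brace])

lemma star_perfect_subset_residual_chain:
  assumes "C \<subseteq> carrier X" "star_set X C C = C"
  shows "C \<subseteq> residual_chain X n"
proof (induction n)
  case 0
  then show ?case using assms by simp
next
  case (Suc n)
  note R = residual_chain_subskew_brace[of n]
  show ?case
    using skew_brace.star_perfect_subset_residual[OF skew_brace_sub[OF R], of C] Suc
    by (simp add: star_set_sub[OF R Suc Suc] assms(2))
qed

lemma subskew_brace_star_subset:
  assumes "subskew_brace S X"
  shows "star_set X S S \<subseteq> S"
  using skew_brace.square_closed[OF skew_brace_sub[OF assms]]
  by (auto simp: star_set_sub[OF assms])

lemma residual_chain_stabilises: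
  assumes "finite (carrier X)"
  obtains N where "\<And>n. n \<ge> N \<Longrightarrow> residual_chain X n = residual_chain X N"
proof -
  have fin: "finite (residual_chain X n)" for n
    using subskew_brace_closed[OF residual_chain_subskew_brace] assms by (rule finite_subset)
  obtain N where N: "\<And>n. card (residual_chain X N) \<le> card (residual_chain X n)"
    using ex_has_least_nat[of "\<lambda>_. True" 0 "\<lambda>n. card (residual_chain X n)"] by blast
  have "residual_chain X n = residual_chain X N" if "n \<ge> N" for n
  proof -
    have "residual_chain X n \<subseteq> residual_chain X N"
      using residual_chain_Suc_subset that by (rule lift_Suc_antimono_le)
    from card_seteq[OF fin this N] show ?thesis .
  qed
  then show ?thesis using that by blast
qed

end

section \<open>The largest star-perfect subskew brace\<close>

theorem proposition7p5:
  fixes X :: "('a, 'm) ring_scheme"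
  assumes "skew_brace X" and "finite (carrier X)"
  shows "\<exists>P. (\<exists>N. \<forall>n\<ge>N. residual_chain X n = P)
           \<and> subskew_brace P X \<and> star_set X P P = P
           \<and> (\<forall>C. subskew_brace C X \<and> star_set X C C = C \<longrightarrow> C \<subseteq> P)"
proof -
  interpret skew_brace X by fact
  obtain N where N: "\<And>n. n \<ge> N \<Longrightarrow> residual_chain X n = residual_chain X N"
    using residual_chain_stabilises[OF assms(2)] by blast
  let ?P = "residual_chain X N"
  have "?P \<subseteq> star_set X ?P ?P"
    using residual_chain_Suc_subset_star[of N] N[of "Suc N"] by simp
  then have "star_set X ?P ?P = ?P"
    using subskew_brace_star_subset[OF residual_chain_subskew_brace] by blast
  moreover have "C \<subseteq> ?P" if "subskew_brace C X" "star_set X C C = C" for C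
    using star_perfect_subset_residual_chain[OF subskew_brace_closed] that .
  ultimately show ?thesis
    using N residual_chain_subskew_brace by blast
qed

end
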